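(* Let $M$ be a von Neumann algebra with predual $M_*$, let $M^{sa}$ be its self-adjoint part and $M_+$ its positive cone. Let $\mathcal C\subseteq M^{sa}$ be a convex cone and let $$\mathcal K:=\overline{\mathcal C-M_+}^{\,\sigma(M^{sa},M_*^{sa})}\subseteq M^{sa}.$$ Assume NAFL$_\sigma$ holds, i.e. there exists $\varepsilon>0$ such that $\varepsilon I\notin\mathcal K$. Then there exists a normal state $\varphi^\star$ on $M$ such that $$\varphi^\star(G)\le 0\qquad\text{for all }G\in\mathcal C .$$
   Context: $\mathcal C$ is a convex cone in the sense that $\lambda_1G_1+\lambda_2G_2\in\mathcal C$ whenever $G_1,G_2\in\mathcal C$ and $\lambda_1,\lambda_2\ge0$ (it models discounted terminal gains attainable at zero initial cost). $M_*^{sa}$ is the space of self-adjoint normal functionals, and $\sigma(M^{sa},M_*^{sa})$ is the weakest topology on $M^{sa}$ making all $X\mapsto\varphi(X)$, $\varphi\in M_*^{sa}$, continuous (the restriction of the ultraweak topology). $\mathcal C-M_+=\{G-P:G\in\mathcal C,\ P\in M_+\}$. A normal state is a positive normal linear functional $\varphi$ with $\varphi(I)=1$. *)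

theory Defs
  imports "HOL-Analysis.Analysis" "HOL-Library.Complex_Order"
begin

section \<open>Complex Hilbert spaces\<close>

class complex_vector = real_vector +
  fixes scaleC :: "complex \<Rightarrow> 'a \<Rightarrow> 'a" (infixr "*\<^sub>C" 75)
  assumes scaleC_add_right: "c *\<^sub>C (x + y) = c *\<^sub>C x + c *\<^sub>C y"
    and scaleC_add_left: "(c + d) *\<^sub>C x = c *\<^sub>C x + d *\<^sub>C x"
    and scaleC_scaleC: "c *\<^sub>C (d *\<^sub>C x) = (c * d) *\<^sub>C x"
    and scaleC_of_real: "complex_of_real r *\<^sub>C x = r *\<^sub>R x"

text \<open>The inner product is antilinear in the first argument and linear in the second one;
  the order in \<open>cinner_ge_zero\<close> is the one of \<^theory>\<open>HOL-Library.Complex_Order\<close>, so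
  \<open>0 \<le> z\<close> means that \<open>z\<close> is real and nonnegative.\<close>

class complex_inner = complex_vector + real_normed_vector +
  fixes cinner :: "'a \<Rightarrow> 'a \<Rightarrow> complex"
  assumes cinner_commute: "cinner x y = cnj (cinner y x)"
    and cinner_add_right: "cinner x (y + z) = cinner x y + cinner x z"
    and cinner_scaleC_right: "cinner x (c *\<^sub>C y) = c * cinner x y"
    and cinner_ge_zero: "0 \<le> cinner x x"
    and cinner_eq_zero_iff: "cinner x x = 0 \<longleftrightarrow> x = 0"
    and norm_eq_sqrt_cinner: "norm x = sqrt (cmod (cinner x x))"

class chilbert_space = complex_inner + complete_space

lemma cinner_scaleC_left: "cinner (c *\<^sub>C x) y = cnj c * cinner x (y::'a::complex_inner)"
  by (metis cinner_commute cinner_scaleC_right complex_cnj_mult)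

lemma norm_scaleC: "norm (c *\<^sub>C x) = cmod c * norm (x::'a::complex_inner)"
proof -
  have "cmod (cinner (c *\<^sub>C x) (c *\<^sub>C x)) = (cmod c)\<^sup>2 * cmod (cinner x x)"
    by (simp add: cinner_scaleC_left cinner_scaleC_right norm_mult power2_eq_square)
  then show ?thesis
    by (simp add: norm_eq_sqrt_cinner real_sqrt_mult)
qed

instantiation complex :: chilbert_space
begin

definition scaleC_complex :: "complex \<Rightarrow> complex \<Rightarrow> complex"
  where "scaleC_complex c x = c * x"

definition cinner_complex :: "complex \<Rightarrow> complex \<Rightarrow> complex"
  where "cinner_complex x y = cnj x * y"

instance
proof
  fix x :: complex
  show "0 \<le> cinner x x"
    by (simp add: cinner_complex_def less_eq_complex_def)
  show "norm x = sqrt (cmod (cinner x x))"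
    by (simp add: cinner_complex_def norm_mult)
qed (auto simp: scaleC_complex_def cinner_complex_def algebra_simps scaleR_conv_of_real)

end


section \<open>Bounded operators\<close>

text \<open>The library's type \<^typ>\<open>'h \<Rightarrow>\<^sub>L 'h\<close> consists of the bounded \<^emph>\<open>real\<close>-linear maps;
  \<open>bounded_ops\<close> singles out the complex-linear ones, i.e. it is \<open>B(H)\<close>.\<close>

instantiation blinfun :: (real_normed_vector, complex_inner) complex_vector
begin

lift_definition scaleC_blinfun :: "complex \<Rightarrow> 'a \<Rightarrow>\<^sub>L 'b \<Rightarrow> 'a \<Rightarrow>\<^sub>L 'b"
  is "\<lambda>c T x. c *\<^sub>C T x"
proof -
  fix c :: complex and T :: "'a \<Rightarrow> 'b"
  assume T: "bounded_linear T"
  then obtain K where K: "\<And>x. norm (T x) \<le> norm x * K"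
    using bounded_linear.bounded by blast
  show "bounded_linear (\<lambda>x. c *\<^sub>C T x)"
  proof (rule bounded_linear_intro[where K = "cmod c * K"])
    fix x y :: 'a and r :: real
    show "c *\<^sub>C T (x + y) = c *\<^sub>C T x + c *\<^sub>C T y"
      using T by (simp add: bounded_linear.axioms linear_add scaleC_add_right bounded_linear.linear)
    show "c *\<^sub>C T (r *\<^sub>R x) = r *\<^sub>R (c *\<^sub>C T x)"
      using T by (simp add: bounded_linear.linear linear_scale scaleC_scaleC mult.commute
          flip: scaleC_of_real)
    show "norm (c *\<^sub>C T x) \<le> norm x * (cmod c * K)"
      using mult_left_mono[OF K, of "cmod c" x] by (simp add: norm_scaleC mult_ac)
  qed
qed

instance
  by standard
    (transfer; simp add: fun_eq_iff scaleC_add_right scaleC_add_left scaleC_scaleC scaleC_of_real)+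

end

definition bounded_ops :: "('h::complex_inner \<Rightarrow>\<^sub>L 'h) set"
  where "bounded_ops = {T. \<forall>c x. blinfun_apply T (c *\<^sub>C x) = c *\<^sub>C blinfun_apply T x}"

definition is_adjoint :: "('h::complex_inner \<Rightarrow>\<^sub>L 'h) \<Rightarrow> ('h \<Rightarrow>\<^sub>L 'h) \<Rightarrow> bool"
  where "is_adjoint T S \<longleftrightarrow>
    (\<forall>x y. cinner (blinfun_apply S x) y = cinner x (blinfun_apply T y))"


section \<open>Von Neumann algebras\<close>

definition commutant :: "('h::complex_inner \<Rightarrow>\<^sub>L 'h) set \<Rightarrow> ('h \<Rightarrow>\<^sub>L 'h) set"
  where "commutant A = {T \<in> bounded_ops. \<forall>S\<in>A. T o\<^sub>L S = S o\<^sub>L T}"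

definition von_neumann_algebra :: "('h::chilbert_space \<Rightarrow>\<^sub>L 'h) set \<Rightarrow> bool"
  where "von_neumann_algebra M \<longleftrightarrow>
    M \<subseteq> bounded_ops \<and> (\<forall>T\<in>M. \<exists>S\<in>M. is_adjoint T S) \<and> commutant (commutant M) = M"

definition self_adjoint_part :: "('h::complex_inner \<Rightarrow>\<^sub>L 'h) set \<Rightarrow> ('h \<Rightarrow>\<^sub>L 'h) set"
  where "self_adjoint_part M = {T \<in> M. is_adjoint T T}"

definition positive_cone :: "('h::complex_inner \<Rightarrow>\<^sub>L 'h) set \<Rightarrow> ('h \<Rightarrow>\<^sub>L 'h) set"
  where "positive_cone M =
    {T \<in> self_adjoint_part M. \<forall>x. 0 \<le> cinner x (blinfun_apply T x)}"


section \<open>Weak topologies, normal functionals and the predual\<close>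

definition weak_topology :: "'a set \<Rightarrow> ('a \<Rightarrow> 'b::topological_space) set \<Rightarrow> 'a topology"
  where "weak_topology S F =
    topology_generated_by (insert S {{x \<in> S. f x \<in> U} |f U. f \<in> F \<and> open U})"

definition square_summable :: "(nat \<Rightarrow> 'h::real_normed_vector) \<Rightarrow> bool"
  where "square_summable x \<longleftrightarrow> summable (\<lambda>n. (norm (x n))\<^sup>2)"

definition ultraweak_topology :: "('h::complex_inner \<Rightarrow>\<^sub>L 'h) topology"
  where "ultraweak_topology = weak_topology bounded_ops
    {\<lambda>T. \<Sum>n. cinner (x n) (blinfun_apply T (y n)) |x y. square_summable x \<and> square_summable y}"

text \<open>Functionals on \<open>M\<close> are total functions on the operator type of which only the values
  on \<open>M\<close> matter.\<close>

definition linear_functional_on ::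
    "('h::complex_inner \<Rightarrow>\<^sub>L 'h) set \<Rightarrow> (('h \<Rightarrow>\<^sub>L 'h) \<Rightarrow> complex) \<Rightarrow> bool"
  where "linear_functional_on M \<phi> \<longleftrightarrow>
    (\<forall>X\<in>M. \<forall>Y\<in>M. \<phi> (X + Y) = \<phi> X + \<phi> Y) \<and>
    (\<forall>c. \<forall>X\<in>M. \<phi> (c *\<^sub>C X) = c * \<phi> X)"

text \<open>The predual is identified with the space of normal, i.e. ultraweakly continuous, linear
  functionals.\<close>

definition predual ::
    "('h::complex_inner \<Rightarrow>\<^sub>L 'h) set \<Rightarrow> (('h \<Rightarrow>\<^sub>L 'h) \<Rightarrow> complex) set"
  where "predual M = {\<phi>. linear_functional_on M \<phi> \<and>
    continuous_map (subtopology ultraweak_topology M) euclidean \<phi>}"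

definition predual_sa ::
    "('h::complex_inner \<Rightarrow>\<^sub>L 'h) set \<Rightarrow> (('h \<Rightarrow>\<^sub>L 'h) \<Rightarrow> complex) set"
  where "predual_sa M =
    {\<phi> \<in> predual M. \<forall>X\<in>M. \<forall>Y\<in>M. is_adjoint X Y \<longrightarrow> \<phi> Y = cnj (\<phi> X)}"

definition sigma_topology :: "('h::complex_inner \<Rightarrow>\<^sub>L 'h) set \<Rightarrow> ('h \<Rightarrow>\<^sub>L 'h) topology"
  where "sigma_topology M = weak_topology (self_adjoint_part M) (predual_sa M)"

definition normal_state ::
    "('h::complex_inner \<Rightarrow>\<^sub>L 'h) set \<Rightarrow> (('h \<Rightarrow>\<^sub>L 'h) \<Rightarrow> complex) \<Rightarrow> bool"
  where "normal_state M \<phi> \<longleftrightarrow>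
    \<phi> \<in> predual M \<and> (\<forall>P\<in>positive_cone M. 0 \<le> \<phi> P) \<and> \<phi> id_blinfun = 1"


section \<open>The no-free-lunch condition\<close>

definition gains_closure ::
    "('h::complex_inner \<Rightarrow>\<^sub>L 'h) set \<Rightarrow> ('h \<Rightarrow>\<^sub>L 'h) set \<Rightarrow> ('h \<Rightarrow>\<^sub>L 'h) set"
  where "gains_closure M C =
    sigma_topology M closure_of {G - P |G P. G \<in> C \<and> P \<in> positive_cone M}"

definition NAFL_sigma ::
    "('h::complex_inner \<Rightarrow>\<^sub>L 'h) set \<Rightarrow> ('h \<Rightarrow>\<^sub>L 'h) set \<Rightarrow> bool"
  where "NAFL_sigma M C \<longleftrightarrow> (\<exists>\<epsilon>>0. \<epsilon> *\<^sub>R id_blinfun \<notin> gains_closure M C)"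

end

theory Submission
  imports Defs
begin

text \<open>Since \<open>\<epsilon>I\<close> is not in the weak closure of the convex cone \<open>D = C - M\<^sub>+\<close>, finitely many
  functionals in the predual already keep \<open>D\<close> at a positive distance from \<open>\<epsilon>I\<close>. Separating in the
  resulting Euclidean space gives a linear combination \<open>\<psi>\<close> of them that is positive at \<open>\<epsilon>I\<close> and
  nonpositive on \<open>D\<close>. As \<open>-M\<^sub>+ \<subseteq> D\<close>, the functional \<open>\<psi>\<close> is positive, and \<open>\<psi>/\<psi>(I)\<close> is the state.\<close>

section \<open>Separation in weak topologies\<close>

text \<open>Induction over the generation of \<open>U\<close>, with the point kept variable. An
  intersection joins the two finite sets of functions and takes the smaller radius; a union keeps
  those of one member.\<close>

lemma openin_weak_topology_imp_finite:
  fixes F :: "('a \<Rightarrow> 'b::metric_space) set"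
  assumes "openin (weak_topology S F) U" "x \<in> U"
  obtains G \<delta> where "finite G" "G \<subseteq> F" "\<delta> > 0"
    "\<And>y. y \<in> S \<Longrightarrow> (\<And>f. f \<in> G \<Longrightarrow> dist (f y) (f x) < \<delta>) \<Longrightarrow> y \<in> U"
proof -
  let ?P = "\<lambda>U. \<forall>x\<in>U. \<exists>G \<delta>. finite G \<and> G \<subseteq> F \<and> \<delta> > 0 \<and>
    (\<forall>y\<in>S. (\<forall>f\<in>G. dist (f y) (f x) < \<delta>) \<longrightarrow> y \<in> U)"
  have "generate_topology_on (insert S {{x \<in> S. f x \<in> U} |f U. f \<in> F \<and> open U}) U"
    using assms(1) by (simp add: weak_topology_def openin_topology_generated_by_iff)
  then have "?P U"
  proof (induction rule: generate_topology_on.induct)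
    case Empty
    then show ?case by simp
  next
    case (Int a b)
    show ?case
    proof
      fix x assume "x \<in> a \<inter> b"
      then obtain G \<delta> G' \<delta>' where
        "finite G" "G \<subseteq> F" "\<delta> > 0" "\<forall>y\<in>S. (\<forall>f\<in>G. dist (f y) (f x) < \<delta>) \<longrightarrow> y \<in> a"
        "finite G'" "G' \<subseteq> F" "\<delta>' > 0" "\<forall>y\<in>S. (\<forall>f\<in>G'. dist (f y) (f x) < \<delta>') \<longrightarrow> y \<in> b"
        using Int.IH by (metis IntD1 IntD2)
      then show "\<exists>G \<delta>. finite G \<and> G \<subseteq> F \<and> \<delta> > 0 \<and>
          (\<forall>y\<in>S. (\<forall>f\<in>G. dist (f y) (f x) < \<delta>) \<longrightarrow> y \<in> a \<inter> b)"
        by (intro exI[of _ "G \<union> G'"] exI[of _ "min \<delta> \<delta>'"]) auto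
    qed
  next
    case (UN K)
    show ?case
    proof
      fix x assume "x \<in> \<Union>K"
      then obtain k where k: "k \<in> K" "x \<in> k" by blast
      then obtain G \<delta> where "finite G" "G \<subseteq> F" "\<delta> > 0"
        "\<forall>y\<in>S. (\<forall>f\<in>G. dist (f y) (f x) < \<delta>) \<longrightarrow> y \<in> k"
        using UN.IH by meson
      with k show "\<exists>G \<delta>. finite G \<and> G \<subseteq> F \<and> \<delta> > 0 \<and>
          (\<forall>y\<in>S. (\<forall>f\<in>G. dist (f y) (f x) < \<delta>) \<longrightarrow> y \<in> \<Union>K)"
        by (intro exI[of _ G] exI[of _ \<delta>]) blast
    qed
  next
    case (Basis V)
    show ?case
    proof
      fix x assume x: "x \<in> V"
      show "\<exists>G \<delta>. finite G \<and> G \<subseteq> F \<and> \<delta> > 0 \<and>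
          (\<forall>y\<in>S. (\<forall>f\<in>G. dist (f y) (f x) < \<delta>) \<longrightarrow> y \<in> V)"
      proof (cases "V = S")
        case True
        \<comment> \<open>The generator \<open>S\<close> restricts no function, so the empty set
          serves; the radius 1 is arbitrary.\<close>
        then show ?thesis by (intro exI[of _ "{}"] exI[of _ 1]) auto
      next
        case False
        with Basis obtain f W where f: "f \<in> F" "open W" "V = {x \<in> S. f x \<in> W}" by auto
        with x obtain \<delta> where "\<delta> > 0" "\<And>z. dist z (f x) < \<delta> \<Longrightarrow> z \<in> W"
          by (auto simp: open_dist)
        with f show ?thesis by (intro exI[of _ "{f}"] exI[of _ \<delta>]) auto
      qed
    qed
  qed
  with assms(2) that show thesis by meson
qed

lemma notin_closure_of_weak_topology:
  fixes F :: "('a \<Rightarrow> 'b::metric_space) set"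
  assumes "x \<in> S" "D \<subseteq> S" "x \<notin> weak_topology S F closure_of D"
  obtains G \<delta> where "finite G" "G \<subseteq> F" "\<delta> > 0"
    "\<And>y. y \<in> D \<Longrightarrow> \<exists>f\<in>G. \<delta> \<le> dist (f y) (f x)"
proof -
  \<comment> \<open>A point outside the space lies in no closure either, so a neighbourhood of
    \<open>x\<close> that misses \<open>D\<close> exists only once \<open>x\<close> is known to be
    in the space.\<close>
  have "x \<in> topspace (weak_topology S F)"
    using assms(1) by (auto simp: weak_topology_def)
  then obtain U where U: "openin (weak_topology S F) U" "x \<in> U" "D \<inter> U = {}"
    using assms(3) by (auto simp: in_closure_of)
  obtain G \<delta> where G: "finite G" "G \<subseteq> F" "\<delta> > 0"
    "\<And>y. y \<in> S \<Longrightarrow> (\<And>f. f \<in> G \<Longrightarrow> dist (f y) (f x) < \<delta>) \<Longrightarrow> y \<in> U"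
    using openin_weak_topology_imp_finite[OF U(1,2)] by metis
  show thesis
  proof (rule that[OF G(1-3)])
    fix y assume "y \<in> D"
    then show "\<exists>f\<in>G. \<delta> \<le> dist (f y) (f x)"
      using G(4)[of y] U(3) assms(2) by (meson disjoint_iff not_less subsetD)
  qed
qed

section \<open>Projection onto the image of a convex cone in a Euclidean space\<close>

text \<open>First-order condition at a nearest point: with \<open>a\<close> the vector from that
  point to the target, a small move along \<open>b\<close> does not come closer. Expanding the
  square, dividing by \<open>t\<close> and letting \<open>t\<close> tend to 0 from the right gives
  the sign.\<close>

lemma sum_mult_nonpos_of_distance_minimal:
  fixes a b :: "'i \<Rightarrow> real"
  assumes "\<And>t. 0 < t \<Longrightarrow> t \<le> 1 \<Longrightarrow> (\<Sum>i\<in>I. (a i)\<^sup>2) \<le> (\<Sum>i\<in>I. (a i - t * b i)\<^sup>2)"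
  shows "(\<Sum>i\<in>I. a i * b i) \<le> 0"
proof -
  let ?A = "\<Sum>i\<in>I. a i * b i" and ?B = "\<Sum>i\<in>I. (b i)\<^sup>2"
  have le: "2 * ?A \<le> t * ?B" if "0 < t" "t \<le> 1" for t
  proof -
    have "(\<Sum>i\<in>I. (a i - t * b i)\<^sup>2) = (\<Sum>i\<in>I. (a i)\<^sup>2) + t * (t * ?B - 2 * ?A)"
      by (simp add: power2_diff power_mult_distrib sum.distrib sum_subtractf sum_distrib_left
          algebra_simps power2_eq_square)
    with assms[OF that] have "0 \<le> t * (t * ?B - 2 * ?A)" by linarith
    with that show ?thesis by (simp add: zero_le_mult_iff)
  qed
  have "eventually (\<lambda>t. 2 * ?A \<le> t * ?B) (at_right 0)"
    using le unfolding eventually_at_right_field by (intro exI[of _ 1]) auto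
  moreover have "((\<lambda>t. t * ?B) \<longlongrightarrow> 0 * ?B) (at_right 0)"
    by (intro tendsto_intros)
  ultimately have "2 * ?A \<le> 0 * ?B"
    by (intro tendsto_lowerbound) auto
  then show ?thesis by simp
qed

text \<open>A minimizing sequence for the distance to \<open>e\<close> is Cauchy by the parallelogram law.\<close>

lemma convex_cone_minimizing_sequence:
  fixes D :: "'v::real_vector set" and f :: "'i \<Rightarrow> 'v \<Rightarrow> real"
  assumes "finite I" "convex_cone D"
    and add: "\<And>i x y. i \<in> I \<Longrightarrow> x \<in> D \<Longrightarrow> y \<in> D \<Longrightarrow> f i (x + y) = f i x + f i y"
    and scale: "\<And>i x c. i \<in> I \<Longrightarrow> x \<in> D \<Longrightarrow> f i (c *\<^sub>R x) = c * f i x"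
  obtains X p where "\<And>n. X n \<in> D" "\<And>i. i \<in> I \<Longrightarrow> (\<lambda>n. f i (X n)) \<longlonglongrightarrow> p i"
    "\<And>x. x \<in> D \<Longrightarrow> (\<Sum>i\<in>I. (e i - p i)\<^sup>2) \<le> (\<Sum>i\<in>I. (e i - f i x)\<^sup>2)"
proof -
  define q where "q x = (\<Sum>i\<in>I. (e i - f i x)\<^sup>2)" for x
  define m where "m = Inf (q ` D)"
  have ne: "q ` D \<noteq> {}" and bdd: "bdd_below (q ` D)"
    using convex_cone_nonempty[OF assms(2)] by (auto simp: q_def sum_nonneg intro!: bdd_belowI[of _ 0])
  have m_le: "m \<le> q x" if "x \<in> D" for x
    unfolding m_def using bdd that by (simp add: cInf_lower)
  have "\<exists>x\<in>D. q x < m + inverse (Suc n)" for n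
    using cInf_lessD[OF ne, of "m + inverse (Suc n)"] by (auto simp: m_def)
  then obtain X where X: "\<And>n. X n \<in> D" "\<And>n. q (X n) < m + inverse (Suc n)" by metis
  \<comment> \<open>The midpoint of \<open>x\<close> and \<open>y\<close> stays in \<open>D\<close>,
    so \<open>q\<close> is at least \<open>m\<close> there, which bounds the remaining term of the
    parallelogram identity.\<close>
  have par: "(f i x - f i y)\<^sup>2 \<le> 2 * (q x - m) + 2 * (q y - m)" if "x \<in> D" "y \<in> D" "i \<in> I" for i x y
  proof -
    have z: "(1/2) *\<^sub>R (x + y) \<in> D"
      using that by (simp add: assms(2) convex_cone_add convex_cone_scaleR)
    have "(\<Sum>i\<in>I. (f i x - f i y)\<^sup>2) + 4 * q ((1/2) *\<^sub>R (x + y)) = 2 * q x + 2 * q y"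
      unfolding q_def sum_distrib_left sum.distrib[symmetric]
    proof (intro sum.cong refl)
      fix j assume "j \<in> I"
      then have "f j ((1/2) *\<^sub>R (x + y)) = (f j x + f j y) / 2"
        using scale[of j "x + y" "1/2"] add[of j x y] that convex_cone_add[OF assms(2)] by simp
      then show "(f j x - f j y)\<^sup>2 + 4 * (e j - f j ((1/2) *\<^sub>R (x + y)))\<^sup>2 =
          2 * (e j - f j x)\<^sup>2 + 2 * (e j - f j y)\<^sup>2"
        by (simp only:) (simp add: power2_eq_square field_simps)
    qed
    moreover have "(f i x - f i y)\<^sup>2 \<le> (\<Sum>i\<in>I. (f i x - f i y)\<^sup>2)"
      using that assms(1) by (intro member_le_sum) auto
    ultimately show ?thesis using m_le[OF z] by argo
  qed
  have "convergent (\<lambda>n. f i (X n))" if i: "i \<in> I" for i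
  proof -
    have "Cauchy (\<lambda>n. f i (X n))"
    proof (rule metric_CauchyI)
      fix r :: real assume r: "0 < r"
      \<comment> \<open>\<open>par\<close> doubles each of two excesses over \<open>m\<close>, so
        excesses below \<open>r^2 / 4\<close> add up to less than \<open>r^2\<close>.\<close>
      then obtain N where N: "inverse (Suc N) < r\<^sup>2 / 4"
        using reals_Archimedean[of "r\<^sup>2 / 4"] by auto
      have small: "q (X n) - m < r\<^sup>2 / 4" if "n \<ge> N" for n
      proof -
        have "inverse (real (Suc n)) \<le> inverse (Suc N)"
          using that by (intro le_imp_inverse_le) auto
        with N X(2)[of n] show ?thesis by linarith
      qed
      have "dist (f i (X j)) (f i (X k)) < r" if "j \<ge> N" "k \<ge> N" for j k
      proof -
        have "(f i (X j) - f i (X k))\<^sup>2 < r\<^sup>2"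
          using par[OF X(1) X(1) i, of j k] small[OF that(1)] small[OF that(2)] by argo
        with r show ?thesis
          using power2_less_imp_less[of "\<bar>f i (X j) - f i (X k)\<bar>" r] by (simp add: dist_real_def)
      qed
      then show "\<exists>N. \<forall>j\<ge>N. \<forall>k\<ge>N. dist (f i (X j)) (f i (X k)) < r" by blast
    qed
    then show ?thesis by (simp add: Cauchy_convergent)
  qed
  then have lim: "(\<lambda>n. f i (X n)) \<longlonglongrightarrow> lim (\<lambda>n. f i (X n))" if "i \<in> I" for i
    using that by (simp add: convergent_LIMSEQ_iff)
  have "(\<lambda>n. q (X n)) \<longlonglongrightarrow> (\<Sum>i\<in>I. (e i - lim (\<lambda>n. f i (X n)))\<^sup>2)"
    unfolding q_def by (intro tendsto_intros lim)
  moreover have "(\<lambda>n. m + inverse (Suc n)) \<longlonglongrightarrow> m"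
    using tendsto_add[OF tendsto_const LIMSEQ_inverse_real_of_nat, of m] by simp
  ultimately have "(\<Sum>i\<in>I. (e i - lim (\<lambda>n. f i (X n)))\<^sup>2) \<le> m"
    by (rule LIMSEQ_le) (use X(2) in \<open>auto intro: less_imp_le\<close>)
  with that[of X "\<lambda>i. lim (\<lambda>n. f i (X n))"] X(1) lim m_le show thesis
    unfolding q_def by (meson order_trans)
qed

text \<open>Take \<open>a = e - p\<close> with \<open>p\<close> nearest to \<open>e\<close> in the
  closure of the image of \<open>D\<close>. Moves along the cone give the first claim; shrinking
  \<open>p\<close> towards 0 shows that \<open>a\<close> has nonnegative product with
  \<open>p\<close>, hence product at least its squared length with \<open>e\<close>. Linearity is
  assumed on \<open>D\<close> only, since functionals on \<open>M\<close> are arbitrary functions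
  outside \<open>M\<close>.\<close>

lemma convex_cone_separation_functionals:
  fixes D :: "'v::real_vector set" and f :: "'i \<Rightarrow> 'v \<Rightarrow> real"
  assumes "finite I" "convex_cone D"
    and add: "\<And>i x y. i \<in> I \<Longrightarrow> x \<in> D \<Longrightarrow> y \<in> D \<Longrightarrow> f i (x + y) = f i x + f i y"
    and scale: "\<And>i x c. i \<in> I \<Longrightarrow> x \<in> D \<Longrightarrow> f i (c *\<^sub>R x) = c * f i x"
    and "0 < \<delta>" and dist: "\<And>x. x \<in> D \<Longrightarrow> \<delta> \<le> (\<Sum>i\<in>I. (e i - f i x)\<^sup>2)"
  obtains a where "\<And>x. x \<in> D \<Longrightarrow> (\<Sum>i\<in>I. a i * f i x) \<le> 0" "0 < (\<Sum>i\<in>I. a i * e i)"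
proof -
  obtain X p where X: "\<And>n. X n \<in> D" and lim: "\<And>i. i \<in> I \<Longrightarrow> (\<lambda>n. f i (X n)) \<longlonglongrightarrow> p i"
    and min: "\<And>x. x \<in> D \<Longrightarrow> (\<Sum>i\<in>I. (e i - p i)\<^sup>2) \<le> (\<Sum>i\<in>I. (e i - f i x)\<^sup>2)"
    by (rule convex_cone_minimizing_sequence[OF assms(1,2), of f e]) (use add scale in blast)+
  define a where "a i = e i - p i" for i
  have "(\<lambda>n. \<Sum>i\<in>I. (e i - f i (X n))\<^sup>2) \<longlonglongrightarrow> (\<Sum>i\<in>I. (a i)\<^sup>2)"
    unfolding a_def by (intro tendsto_intros lim)
  then have pos: "\<delta> \<le> (\<Sum>i\<in>I. (a i)\<^sup>2)"
    by (rule LIMSEQ_le_const) (use dist X in blast)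
  have nonpos: "(\<Sum>i\<in>I. a i * f i x) \<le> 0" if x: "x \<in> D" for x
  proof (rule sum_mult_nonpos_of_distance_minimal)
    fix t :: real assume "0 < t" "t \<le> 1"
    then have D: "t *\<^sub>R x \<in> D" "X n + t *\<^sub>R x \<in> D" for n
      using x X assms(2) by (simp_all add: convex_cone_add convex_cone_scaleR)
    \<comment> \<open>The image of \<open>D\<close> need not be closed, so \<open>p\<close> need not
      come from a point of \<open>D\<close>. Minimality is applied to
      \<open>X n + t *\<^sub>R x\<close>, and the limit in \<open>n\<close> transfers it to
      \<open>p\<close>.\<close>
    have "(\<lambda>n. \<Sum>i\<in>I. (e i - (f i (X n) + t * f i x))\<^sup>2) \<longlonglongrightarrow>
        (\<Sum>i\<in>I. (e i - (p i + t * f i x))\<^sup>2)"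
      by (intro tendsto_intros lim)
    moreover have "(\<Sum>i\<in>I. (a i)\<^sup>2) \<le> (\<Sum>i\<in>I. (e i - (f i (X n) + t * f i x))\<^sup>2)" for n
      using min[OF D(2)] by (simp add: a_def add scale x X D(1) cong: sum.cong)
    ultimately have "(\<Sum>i\<in>I. (a i)\<^sup>2) \<le> (\<Sum>i\<in>I. (e i - (p i + t * f i x))\<^sup>2)"
      by (intro LIMSEQ_le_const) auto
    then show "(\<Sum>i\<in>I. (a i)\<^sup>2) \<le> (\<Sum>i\<in>I. (a i - t * f i x)\<^sup>2)"
      by (simp add: a_def algebra_simps)
  qed
  \<comment> \<open>The direction is \<open>- p\<close>: scaling by \<open>1 - t\<close> stays in
    the cone because \<open>t \<le> 1\<close>.\<close>
  have "(\<Sum>i\<in>I. a i * - p i) \<le> 0"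
  proof (rule sum_mult_nonpos_of_distance_minimal)
    fix t :: real assume "0 < t" "t \<le> 1"
    then have D: "(1 - t) *\<^sub>R X n \<in> D" for n
      using X assms(2) by (simp add: convex_cone_scaleR)
    have "(\<lambda>n. \<Sum>i\<in>I. (e i - (1 - t) * f i (X n))\<^sup>2) \<longlonglongrightarrow> (\<Sum>i\<in>I. (e i - (1 - t) * p i)\<^sup>2)"
      by (intro tendsto_intros lim)
    moreover have "(\<Sum>i\<in>I. (a i)\<^sup>2) \<le> (\<Sum>i\<in>I. (e i - (1 - t) * f i (X n))\<^sup>2)" for n
      using min[OF D] by (simp add: a_def scale X cong: sum.cong)
    ultimately have "(\<Sum>i\<in>I. (a i)\<^sup>2) \<le> (\<Sum>i\<in>I. (e i - (1 - t) * p i)\<^sup>2)"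
      by (intro LIMSEQ_le_const) auto
    then show "(\<Sum>i\<in>I. (a i)\<^sup>2) \<le> (\<Sum>i\<in>I. (a i - t * - p i)\<^sup>2)"
      by (simp add: a_def algebra_simps)
  qed
  moreover have "(\<Sum>i\<in>I. a i * e i) = (\<Sum>i\<in>I. (a i)\<^sup>2) - (\<Sum>i\<in>I. a i * - p i)"
    unfolding sum_subtractf[symmetric]
    by (intro sum.cong refl) (simp add: a_def power2_eq_square algebra_simps)
  ultimately have "0 < (\<Sum>i\<in>I. a i * e i)" using pos \<open>0 < \<delta>\<close> by linarith
  with nonpos that show thesis by blast
qed

section \<open>Self-adjoint operators and the predual\<close>

lemma cinner_add_left: "cinner (x + y) z = cinner x z + cinner y (z::'a::complex_inner)"
  by (metis cinner_add_right cinner_commute complex_cnj_add)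

lemma cinner_scaleR_right: "cinner x (r *\<^sub>R y) = of_real r * cinner x (y::'a::complex_inner)"
  by (metis cinner_scaleC_right scaleC_of_real)

lemma cinner_scaleR_left: "cinner (r *\<^sub>R x) y = of_real r * cinner x (y::'a::complex_inner)"
  by (metis cinner_scaleC_left scaleC_of_real complex_cnj_complex_of_real)

lemma cinner_zero [simp]: "cinner 0 (y::'a::complex_inner) = 0" "cinner (y::'a) 0 = 0"
  using cinner_scaleR_left[of 0 y y] cinner_scaleR_right[of y 0 y] by simp_all

lemma id_blinfun_in_commutant: "id_blinfun \<in> commutant A"
  by (auto simp: commutant_def bounded_ops_def intro!: blinfun_eqI)

lemma commutant_add: "S \<in> commutant A \<Longrightarrow> T \<in> commutant A \<Longrightarrow> S + T \<in> commutant A"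
  by (simp add: commutant_def bounded_ops_def blinfun.add_left scaleC_add_right
      bounded_bilinear.add_left[OF bounded_bilinear_blinfun_compose]
      bounded_bilinear.add_right[OF bounded_bilinear_blinfun_compose])

lemma scaleR_scaleC: "r *\<^sub>R (c *\<^sub>C x) = c *\<^sub>C (r *\<^sub>R (x::'a::complex_vector))"
  by (simp add: scaleC_scaleC mult.commute flip: scaleC_of_real)

lemma commutant_scaleR: "T \<in> commutant A \<Longrightarrow> r *\<^sub>R T \<in> commutant A"
  by (simp add: commutant_def bounded_ops_def blinfun.scaleR_left scaleR_scaleC
      bounded_bilinear.scaleR_left[OF bounded_bilinear_blinfun_compose]
      bounded_bilinear.scaleR_right[OF bounded_bilinear_blinfun_compose])

context
  fixes M :: "('h::chilbert_space \<Rightarrow>\<^sub>L 'h) set"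
  assumes M: "von_neumann_algebra M"
begin

text \<open>The definition of a von Neumann algebra does not list closure under linear operations;
  it follows because \<open>M\<close> equals its bicommutant and is thus a commutant.\<close>

lemma subspace_self_adjoint_part: "subspace (self_adjoint_part M)"
proof -
  obtain A where "M = commutant A" using M by (auto simp: von_neumann_algebra_def)
  moreover have "0 \<in> commutant A"
    using commutant_scaleR[OF id_blinfun_in_commutant, of 0] by simp
  ultimately show ?thesis
    by (auto simp: subspace_def self_adjoint_part_def is_adjoint_def commutant_add commutant_scaleR
        blinfun.add_left blinfun.scaleR_left cinner_add_left cinner_add_right
        cinner_scaleR_left cinner_scaleR_right)
qed

lemma id_blinfun_in_self_adjoint_part: "id_blinfun \<in> self_adjoint_part M"
proof -
  have "id_blinfun \<in> M"
    using M id_blinfun_in_commutant[of "commutant M"] by (simp add: von_neumann_algebra_def)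
  then show ?thesis by (simp add: self_adjoint_part_def is_adjoint_def)
qed

lemma convex_cone_positive_cone: "convex_cone (positive_cone M)"
  using subspace_self_adjoint_part
  by (auto simp: convex_cone_iff positive_cone_def subspace_def blinfun.add_left blinfun.scaleR_left
      cinner_add_right cinner_scaleR_right less_eq_complex_def)

end

section \<open>Self-adjoint normal functionals as a real vector space\<close>

lemma predual_sa_linear:
  assumes "\<phi> \<in> predual_sa M"
  shows "X \<in> M \<Longrightarrow> Y \<in> M \<Longrightarrow> \<phi> (X + Y) = \<phi> X + \<phi> Y" "X \<in> M \<Longrightarrow> \<phi> (r *\<^sub>R X) = of_real r * \<phi> X"
proof -
  have lin: "linear_functional_on M \<phi>" using assms by (simp add: predual_sa_def predual_def)
  show "\<phi> (X + Y) = \<phi> X + \<phi> Y" if "X \<in> M" "Y \<in> M"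
    using lin that by (simp add: linear_functional_on_def)
  show "\<phi> (r *\<^sub>R X) = of_real r * \<phi> X" if "X \<in> M"
    using lin that unfolding linear_functional_on_def scaleC_of_real[symmetric] by blast
qed

text \<open>\<open>X\<close> is its own adjoint, so its value equals its own conjugate. This lets a
  separation over the reals work with complex-valued functionals.\<close>

lemma predual_sa_real:
  assumes "\<phi> \<in> predual_sa M" "X \<in> self_adjoint_part M"
  shows "\<phi> X = of_real (Re (\<phi> X))"
proof -
  have "\<phi> X = cnj (\<phi> X)"
    using assms unfolding predual_sa_def self_adjoint_part_def by blast
  then show ?thesis by (simp add: complex_eq_iff)
qed

text \<open>Real coefficients commute with conjugation, so self-adjointness survives along with
  linearity and continuity. This serves both for the separating combination and for its
  normalisation.\<close>

lemma predual_sa_sum: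
  assumes "finite G" "G \<subseteq> predual_sa M"
  shows "(\<lambda>X. \<Sum>\<phi>\<in>G. of_real (a \<phi>) * \<phi> X) \<in> predual_sa M"
proof -
  have "continuous_map (subtopology ultraweak_topology M) euclidean (\<lambda>X. of_real (a \<phi>) * \<phi> X)"
    if "\<phi> \<in> G" for \<phi>
  proof -
    have "continuous_map (subtopology ultraweak_topology M) euclidean \<phi>"
      using that assms(2) by (auto simp: predual_sa_def predual_def)
    moreover have "continuous_map euclidean euclidean (\<lambda>z. complex_of_real (a \<phi>) * z)"
      by (simp add: continuous_intros)
    ultimately show ?thesis
      using continuous_map_compose[of _ euclidean \<phi> euclidean "\<lambda>z. complex_of_real (a \<phi>) * z"]
      by (simp add: o_def)
  qed
  then have "continuous_map (subtopology ultraweak_topology M) euclidean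
      (\<lambda>X. \<Sum>\<phi>\<in>G. of_real (a \<phi>) * \<phi> X)"
    by (intro continuous_map_sum assms(1))
  moreover have "linear_functional_on M (\<lambda>X. \<Sum>\<phi>\<in>G. of_real (a \<phi>) * \<phi> X)"
    unfolding linear_functional_on_def sum_distrib_left sum.distrib[symmetric]
  proof (intro conjI ballI allI sum.cong refl)
    fix X Y \<phi> assume "X \<in> M" "Y \<in> M" "\<phi> \<in> G"
    moreover from this have "\<phi> \<in> predual M" using assms(2) by (auto simp: predual_sa_def)
    ultimately show "of_real (a \<phi>) * \<phi> (X + Y) = of_real (a \<phi>) * \<phi> X + of_real (a \<phi>) * \<phi> Y"
      by (simp add: predual_def linear_functional_on_def distrib_left)
  next
    fix X c \<phi> assume "X \<in> M" "\<phi> \<in> G"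
    moreover from this have "\<phi> \<in> predual M" using assms(2) by (auto simp: predual_sa_def)
    ultimately show "of_real (a \<phi>) * \<phi> (c *\<^sub>C X) = c * (of_real (a \<phi>) * \<phi> X)"
      by (simp add: predual_def linear_functional_on_def)
  qed
  moreover have "(\<Sum>\<phi>\<in>G. of_real (a \<phi>) * \<phi> Y) = cnj (\<Sum>\<phi>\<in>G. of_real (a \<phi>) * \<phi> X)"
    if "X \<in> M" "Y \<in> M" "is_adjoint X Y" for X Y
    unfolding cnj_sum
  proof (rule sum.cong[OF refl])
    fix \<phi> assume "\<phi> \<in> G"
    then have "\<phi> \<in> predual_sa M" using assms(2) by blast
    with that have "\<phi> Y = cnj (\<phi> X)" unfolding predual_sa_def by blast
    then show "of_real (a \<phi>) * \<phi> Y = cnj (of_real (a \<phi>) * \<phi> X)" by simp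
  qed
  ultimately show ?thesis
    by (simp add: predual_sa_def predual_def)
qed

theorem theorem5p28:
  fixes M C :: "('h::chilbert_space \<Rightarrow>\<^sub>L 'h) set"
  assumes "von_neumann_algebra M"
    and "C \<subseteq> self_adjoint_part M"
    and "convex_cone C"
    and "NAFL_sigma M C"
  shows "\<exists>\<phi>. normal_state M \<phi> \<and> (\<forall>G\<in>C. \<phi> G \<le> 0)"
proof -
  note M = assms(1)

  \<comment> \<open>The convex cone of gains minus positive operators\<close>
  define D where "D = {G - P |G P. G \<in> C \<and> P \<in> positive_cone M}"
  obtain \<epsilon> where \<epsilon>: "\<epsilon> > 0"
    "\<epsilon> *\<^sub>R id_blinfun \<notin> weak_topology (self_adjoint_part M) (predual_sa M) closure_of D"
    using assms(4) by (auto simp: NAFL_sigma_def gains_closure_def sigma_topology_def D_def)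
  note sub = subspace_self_adjoint_part[OF M]
  have pos_sa: "positive_cone M \<subseteq> self_adjoint_part M" by (auto simp: positive_cone_def)
  have D_sa: "D \<subseteq> self_adjoint_part M"
    using assms(2) pos_sa by (auto simp: D_def intro!: subspace_diff[OF sub])
  have sa_M: "self_adjoint_part M \<subseteq> M" by (auto simp: self_adjoint_part_def)
  have cone: "convex_cone D"
    unfolding convex_cone_iff
  proof (intro conjI ballI allI impI)
    show "0 \<in> D"
      using assms(3) convex_cone_positive_cone[OF M] by (force simp: D_def convex_cone_iff)
  next
    fix X Y assume "X \<in> D" "Y \<in> D"
    then obtain G P G' P' where
      "X = G - P" "Y = G' - P'" "G + G' \<in> C" "P + P' \<in> positive_cone M"
      using assms(3) convex_cone_positive_cone[OF M] by (auto simp: D_def convex_cone_iff)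
    then show "X + Y \<in> D" by (force simp: D_def)
  next
    fix X and c :: real assume "X \<in> D" "0 \<le> c"
    then obtain G P where "X = G - P" "c *\<^sub>R G \<in> C" "c *\<^sub>R P \<in> positive_cone M"
      using assms(3) convex_cone_positive_cone[OF M] by (auto simp: D_def convex_cone_iff)
    then show "c *\<^sub>R X \<in> D" by (force simp: D_def scaleR_diff_right)
  qed
  \<comment> \<open>Both cones contain 0, so \<open>D\<close> contains \<open>C\<close> and the
    negatives of the positive operators; these two inclusions yield the sign on \<open>C\<close> and
    the positivity of the state.\<close>
  have CD: "G \<in> D" if "G \<in> C" for G
    using that convex_cone_contains_0[OF convex_cone_positive_cone[OF M]]
    by (force simp: D_def)
  have PD: "- P \<in> D" if "P \<in> positive_cone M" for P
    using that convex_cone_contains_0[OF assms(3)] by (force simp: D_def)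

  \<comment> \<open>Separation of the multiple of the identity by finitely many functionals\<close>
  let ?E = "\<epsilon> *\<^sub>R id_blinfun"
  have E_sa: "?E \<in> self_adjoint_part M"
    using subspace_scale[OF sub] id_blinfun_in_self_adjoint_part[OF M] by blast
  obtain F \<delta> where F: "finite F" "F \<subseteq> predual_sa M" "\<delta> > 0"
    and far: "\<And>X. X \<in> D \<Longrightarrow> \<exists>\<phi>\<in>F. \<delta> \<le> dist (\<phi> X) (\<phi> ?E)"
    using notin_closure_of_weak_topology[OF E_sa D_sa \<epsilon>(2)] by metis
  have lin: "Re (\<phi> (X + Y)) = Re (\<phi> X) + Re (\<phi> Y)" "Re (\<phi> (c *\<^sub>R X)) = c * Re (\<phi> X)"
    if "\<phi> \<in> F" "X \<in> D" "Y \<in> D" for \<phi> X Y c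
  proof -
    have "\<phi> \<in> predual_sa M" "X \<in> M" "Y \<in> M" using that F(2) D_sa sa_M by blast+
    then show "Re (\<phi> (X + Y)) = Re (\<phi> X) + Re (\<phi> Y)" "Re (\<phi> (c *\<^sub>R X)) = c * Re (\<phi> X)"
      by (simp_all add: predual_sa_linear)
  qed
  \<comment> \<open>Values at self-adjoint operators are real, so passing to real parts loses no
    distance; the one functional in \<open>F\<close> that is at least \<open>\<delta>\<close> away
    already contributes \<open>\<delta>^2\<close>.\<close>
  have sep: "\<delta>\<^sup>2 \<le> (\<Sum>\<phi>\<in>F. (Re (\<phi> ?E) - Re (\<phi> X))\<^sup>2)" if X: "X \<in> D" for X
  proof -
    obtain \<phi> where \<phi>: "\<phi> \<in> F" "\<delta> \<le> dist (\<phi> X) (\<phi> ?E)" using far[OF X] by blast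
    then have "\<phi> \<in> predual_sa M" using F(2) by blast
    then have "dist (\<phi> X) (\<phi> ?E) = dist (complex_of_real (Re (\<phi> X))) (of_real (Re (\<phi> ?E)))"
      using predual_sa_real D_sa X E_sa by (metis subsetD)
    then have "dist (\<phi> X) (\<phi> ?E) = \<bar>Re (\<phi> X) - Re (\<phi> ?E)\<bar>"
      by (simp only: dist_of_real dist_real_def)
    then have "\<delta>\<^sup>2 \<le> (Re (\<phi> ?E) - Re (\<phi> X))\<^sup>2"
      using \<phi>(2) F(3) by (metis abs_le_square_iff abs_minus_commute abs_of_pos)
    also have "\<dots> \<le> (\<Sum>\<phi>\<in>F. (Re (\<phi> ?E) - Re (\<phi> X))\<^sup>2)"
      using \<phi>(1) F(1) by (intro member_le_sum) auto
    finally show ?thesis .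
  qed
  obtain a where a: "\<And>X. X \<in> D \<Longrightarrow> (\<Sum>\<phi>\<in>F. a \<phi> * Re (\<phi> X)) \<le> 0"
      "0 < (\<Sum>\<phi>\<in>F. a \<phi> * Re (\<phi> ?E))"
  proof (rule convex_cone_separation_functionals[OF F(1) cone, where f = "\<lambda>\<phi> X. Re (\<phi> X)"
        and e = "\<lambda>\<phi>. Re (\<phi> ?E)" and \<delta> = "\<delta>\<^sup>2"])
    show "0 < \<delta>\<^sup>2" using F(3) by simp
  qed (use lin sep in blast)+

  \<comment> \<open>Normalisation of the separating functional to a state\<close>
  define \<psi> where "\<psi> X = (\<Sum>\<phi>\<in>F. of_real (a \<phi>) * \<phi> X)" for X
  have \<psi>: "\<psi> \<in> predual_sa M" unfolding \<psi>_def by (rule predual_sa_sum[OF F(1,2)])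
  note \<psi>_real = predual_sa_real[OF \<psi>] and \<psi>_lin = predual_sa_linear[OF \<psi>]
  have Re_\<psi>: "Re (\<psi> X) = (\<Sum>\<phi>\<in>F. a \<phi> * Re (\<phi> X))" for X by (simp add: \<psi>_def)
  have I: "id_blinfun \<in> self_adjoint_part M" by (rule id_blinfun_in_self_adjoint_part[OF M])
  define k where "k = Re (\<psi> id_blinfun)"
  \<comment> \<open>Strict positivity at \<open>?E\<close> is what makes \<open>k\<close> positive,
    so that dividing by it is possible and preserves signs.\<close>
  have "Re (\<psi> ?E) = \<epsilon> * k" using \<psi>_lin(2) I sa_M by (simp add: k_def subset_iff)
  then have k: "k > 0" using a(2) \<epsilon>(1) by (simp add: Re_\<psi>[symmetric] zero_less_mult_iff)
  define \<omega> where "\<omega> X = of_real (inverse k) * \<psi> X" for X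
  have \<omega>: "\<omega> \<in> predual_sa M"
    using predual_sa_sum[of "{\<psi>}" M "\<lambda>_. inverse k"] \<psi> by (simp add: \<omega>_def[abs_def])
  have "Re (\<psi> P) \<ge> 0" if "P \<in> positive_cone M" for P
  proof -
    have "\<psi> (- P) = - \<psi> P"
      using \<psi>_lin(2)[of P "-1"] that pos_sa sa_M by auto
    with a(1)[OF PD[OF that]] show ?thesis by (simp add: Re_\<psi>[symmetric])
  qed
  \<comment> \<open>The order on the complex numbers also demands equal imaginary parts;
    \<open>\<psi>_real\<close> supplies this.\<close>
  then have "\<forall>P\<in>positive_cone M. 0 \<le> \<omega> P"
    using \<psi>_real pos_sa k by (auto simp: \<omega>_def less_eq_complex_def complex_eq_iff subset_iff)
  moreover have "\<omega> id_blinfun = 1"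
    using \<psi>_real[OF I] k by (auto simp: \<omega>_def k_def complex_eq_iff power2_eq_square)
  ultimately have "normal_state M \<omega>"
    using \<omega> by (simp add: normal_state_def predual_sa_def)
  moreover have "\<omega> G \<le> 0" if G: "G \<in> C" for G
  proof -
    \<comment> \<open>Writing the value as a real number reduces the complex inequality to the real
      one obtained from the separation.\<close>
    have "\<omega> G = of_real (inverse k * Re (\<psi> G))"
      using \<psi>_real[of G] assms(2) G unfolding \<omega>_def of_real_mult by auto
    moreover have "inverse k * Re (\<psi> G) \<le> 0"
      using a(1)[OF CD[OF G]] k by (intro mult_nonneg_nonpos) (simp_all add: Re_\<psi>)
    ultimately show ?thesis
      by (simp only: less_eq_complex_def complex.sel Re_complex_of_real Im_complex_of_real
          zero_complex.sel simp_thms)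
  qed
  ultimately show ?thesis by blast
qed

end
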